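(* Let $G$ be an automatic group with an automatic structure $L$ for $\pi_1:A^*\to G$, and let $\varphi$ be a virtually injective endomorphism of $G$ (i.e. with finite kernel) whose image $G\varphi$ is $L$-quasiconvex. Then there is some automatic structure $\tilde L$ for $G$ such that the synchronous BRP holds for $(\varphi,\tilde L,L)$.
   Context: Maps are written on the right. Let $A$ be a finite alphabet and $\pi:A^*\to G$ a surjective (monoid) homomorphism onto a group $G$. $d_A$ denotes the geodesic (word) metric on the Cayley graph $\Gamma_A(G)$ of $G$ with respect to $A\pi$. For a word $u$, $u^{[n]}$ is its prefix with $n$ letters, and $u^{[n]}=u$ if $n>|u|$. A language $L\subseteq A^*$ is a section of $\pi$ if $L\pi=G$. An automatic structure for $\pi$ is a rational (regular) section $L$ of $\pi$ such that for every $x\in A\cup\{1\}$ the set of convolutions $\{u\diamond v\mid u,v\in L,\ v\pi=(ux)\pi\}$ is recognized by a finite state automaton; equivalently, $L$ is a rational section and there is $N\in\mathbb N$ such that for all $u,v\in L$ with $d_A(u\pi,v\pi)\le 1$ one has $d_A(u^{[n]}\pi,v^{[n]}\pi)\le N$ for all $n\in\mathbb N$ (fellow traveller property). $G$ is automatic if it has an automatic structure (for some $A,\pi$); different automatic structures of $G$ may use different alphabets and different $\pi$. A subgroup $H\le G$ is $L$-quasiconvex if there is $N$ such that for all $h,h'\in H$ and $w\in L$ with $h(w\pi)=h'$, one has $d_A(h(w^{[n]}\pi),H)\le N$ for all $n\in\mathbb N$. Synchronous BRP: let $\varphi:G_1\to G_2$ be a homomorphism between automatic groups with automatic structures $L_1$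 for $\pi_1:A^*\to G_1$ and $L_2$ for $\pi_2:B^*\to G_2$. For a word $u$ and group element $x$ write $\theta_u^x(n)=x(u^{[n]}\pi)$, with $\pi$ the relevant homomorphism. The synchronous BRP holds for $(\varphi,L_1,L_2)$ if there is $N>0$ such that $d_B\big((\theta_\alpha^x(n))\varphi,\theta_\beta^{x\varphi}(n)\big)\le N$ for all $n\in\mathbb N$, $x\in G_1$, $\alpha\in L_1$ and $\beta\in L_2$ with $\beta\pi_2=\alpha\pi_1\varphi$. *)

theory Defs
  imports "HOL-Algebra.Coset"
begin

text \<open>A map from \<open>A*\<close> to \<open>G\<close> is a function on lists of which only the values on \<open>lists A\<close>
  matter.\<close>

definition free_monoid :: "'a set \<Rightarrow> 'a list monoid" where
  "free_monoid A = \<lparr>carrier = lists A, mult = (@), one = []\<rparr>"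

text \<open>The condition \<open>\<pi> [] = \<one>\<close> is not listed: a multiplicative map into a group satisfies it.\<close>

definition generating_hom :: "('g, 'm) monoid_scheme \<Rightarrow> 'a set \<Rightarrow> ('a list \<Rightarrow> 'g) \<Rightarrow> bool" where
  "generating_hom G A \<pi> \<longleftrightarrow> finite A \<and> \<pi> \<in> epi (free_monoid A) G"


section \<open>Word metric\<close>

definition cayley_edges :: "('g, 'm) monoid_scheme \<Rightarrow> 'a set \<Rightarrow> ('a list \<Rightarrow> 'g) \<Rightarrow> 'g rel" where
  "cayley_edges G A \<pi> = {(g, g \<otimes>\<^bsub>G\<^esub> \<pi> [a]) | g a. g \<in> carrier G \<and> a \<in> A}"

text \<open>The letters only generate \<open>G\<close> as a monoid and need not be closed under inverses. The distance
  is that of the Cayley graph, so edges may be traversed in both directions. For a generating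
  homomorphism the graph is connected, so the minimum exists.\<close>

definition word_dist ::
    "('g, 'm) monoid_scheme \<Rightarrow> 'a set \<Rightarrow> ('a list \<Rightarrow> 'g) \<Rightarrow> 'g \<Rightarrow> 'g \<Rightarrow> nat" where
  "word_dist G A \<pi> g h =
     (LEAST n. (g, h) \<in> (cayley_edges G A \<pi> \<union> (cayley_edges G A \<pi>)\<inverse>) ^^ n)"

definition word_dist_set ::
    "('g, 'm) monoid_scheme \<Rightarrow> 'a set \<Rightarrow> ('a list \<Rightarrow> 'g) \<Rightarrow> 'g \<Rightarrow> 'g set \<Rightarrow> nat" where
  "word_dist_set G A \<pi> g H = (INF h\<in>H. word_dist G A \<pi> g h)"

definition word_path :: "('g, 'm) monoid_scheme \<Rightarrow> ('a list \<Rightarrow> 'g) \<Rightarrow> 'a list \<Rightarrow> 'g \<Rightarrow> nat \<Rightarrow> 'g" where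
  "word_path G \<pi> u x n = x \<otimes>\<^bsub>G\<^esub> \<pi> (take n u)"


section \<open>Rational languages and convolutions\<close>

inductive nfa_run :: "('q \<times> 's \<times> 'q) set \<Rightarrow> 'q \<Rightarrow> 's list \<Rightarrow> 'q \<Rightarrow> bool" for T where
  "nfa_run T p [] p"
| "(p, a, q) \<in> T \<Longrightarrow> nfa_run T q w r \<Longrightarrow> nfa_run T p (a # w) r"

text \<open>Taking the states to be natural numbers loses nothing, since state sets are finite.\<close>

definition rational :: "'s set \<Rightarrow> 's list set \<Rightarrow> bool" where
  "rational \<Sigma> L \<longleftrightarrow>
     (\<exists>(Q :: nat set) I F T. finite Q \<and> I \<subseteq> Q \<and> F \<subseteq> Q \<and> T \<subseteq> Q \<times> \<Sigma> \<times> Q \<and>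
        L = {w. \<exists>p\<in>I. \<exists>q\<in>F. nfa_run T p w q})"

text \<open>The convolution of two words; \<open>None\<close> is the padding symbol, appended to the shorter word.\<close>

fun convolution :: "'a list \<Rightarrow> 'a list \<Rightarrow> ('a option \<times> 'a option) list" where
  "convolution [] [] = []"
| "convolution (a # u) [] = (Some a, None) # convolution u []"
| "convolution [] (b # v) = (None, Some b) # convolution [] v"
| "convolution (a # u) (b # v) = (Some a, Some b) # convolution u v"

definition padded_alphabet :: "'a set \<Rightarrow> ('a option \<times> 'a option) set" where
  "padded_alphabet A =
     (insert None (Some ` A) \<times> insert None (Some ` A)) - {(None, None)}"


section \<open>Automatic structures, quasiconvexity, bounded reduction\<close>

text \<open>In \<open>automatic_structure\<close>, the word \<open>x\<close> runs over the letters and the empty word,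
  the latter representing the element \<open>1\<close> of \<open>A \<union> {1}\<close>.\<close>

definition is_section :: "('g, 'm) monoid_scheme \<Rightarrow> 'a set \<Rightarrow> ('a list \<Rightarrow> 'g) \<Rightarrow> 'a list set \<Rightarrow> bool" where
  "is_section G A \<pi> L \<longleftrightarrow> L \<subseteq> lists A \<and> \<pi> ` L = carrier G"

definition automatic_structure ::
    "('g, 'm) monoid_scheme \<Rightarrow> 'a set \<Rightarrow> ('a list \<Rightarrow> 'g) \<Rightarrow> 'a list set \<Rightarrow> bool" where
  "automatic_structure G A \<pi> L \<longleftrightarrow>
     generating_hom G A \<pi> \<and> is_section G A \<pi> L \<and> rational A L \<and>
     (\<forall>x \<in> insert [] ((\<lambda>a. [a]) ` A).
        rational (padded_alphabet A)
          {convolution u v | u v. u \<in> L \<and> v \<in> L \<and> \<pi> v = \<pi> (u @ x)})"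

definition quasiconvex ::
    "('g, 'm) monoid_scheme \<Rightarrow> 'a set \<Rightarrow> ('a list \<Rightarrow> 'g) \<Rightarrow> 'a list set \<Rightarrow> 'g set \<Rightarrow> bool" where
  "quasiconvex G A \<pi> L H \<longleftrightarrow>
     subgroup H G \<and>
     (\<exists>N. \<forall>h\<in>H. \<forall>h'\<in>H. \<forall>w\<in>L. h \<otimes>\<^bsub>G\<^esub> \<pi> w = h' \<longrightarrow>
        (\<forall>n. word_dist_set G A \<pi> (h \<otimes>\<^bsub>G\<^esub> \<pi> (take n w)) H \<le> N))"

definition virtually_injective_endo :: "('g, 'm) monoid_scheme \<Rightarrow> ('g \<Rightarrow> 'g) \<Rightarrow> bool" where
  "virtually_injective_endo G \<phi> \<longleftrightarrow> \<phi> \<in> hom G G \<and> finite (kernel G G \<phi>)"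

text \<open>The alphabet \<open>A\<close> of \<open>L\<^sub>1\<close> does not enter the condition; distances are
  measured in the target group with respect to the alphabet \<open>B\<close> of \<open>L\<^sub>2\<close>.\<close>

definition synchronous_BRP ::
    "('g, 'm) monoid_scheme \<Rightarrow> ('a list \<Rightarrow> 'g) \<Rightarrow> 'a list set \<Rightarrow>
     ('h, 'n) monoid_scheme \<Rightarrow> 'b set \<Rightarrow> ('b list \<Rightarrow> 'h) \<Rightarrow> 'b list set \<Rightarrow> ('g \<Rightarrow> 'h) \<Rightarrow> bool" where
  "synchronous_BRP G\<^sub>1 \<pi>\<^sub>1 L\<^sub>1 G\<^sub>2 B \<pi>\<^sub>2 L\<^sub>2 \<phi> \<longleftrightarrow>
     (\<exists>N>0. \<forall>n. \<forall>x\<in>carrier G\<^sub>1. \<forall>\<alpha>\<in>L\<^sub>1. \<forall>\<beta>\<in>L\<^sub>2. \<pi>\<^sub>2 \<beta> = \<phi> (\<pi>\<^sub>1 \<alpha>) \<longrightarrow>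
        word_dist G\<^sub>2 B \<pi>\<^sub>2 (\<phi> (word_path G\<^sub>1 \<pi>\<^sub>1 \<alpha> x n)) (word_path G\<^sub>2 \<pi>\<^sub>2 \<beta> (\<phi> x) n) \<le> N)"

end

theory Submission
  imports Defs
begin

text \<open>Let \<open>H\<close> be the image of \<open>\<phi>\<close>. If \<open>w \<in> L\<close> represents an element of \<open>H\<close>, quasiconvexity keeps
  the path of \<open>w\<close> within bounded distance of \<open>H\<close>, so that every prefix of \<open>w\<close> has a nearby point
  \<open>\<phi> k\<^sub>i\<close> of \<open>H\<close>. The elements \<open>b\<^sub>i = k\<^sub>i\<inverse> k\<^sub>i\<^sub>+\<^sub>1\<close> have images of bounded length, and since the kernel
  is finite they range over a finite set \<open>S\<close>. Reading \<open>b\<^sub>0 b\<^sub>1 \<dots>\<close> therefore gives a word over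
  a finite alphabet whose image under \<open>\<phi>\<close> travels along \<open>w\<close>, and the new language consists of all these
  lifts of words of \<open>L\<close>.

  Two devices make this work. Each letter carries, besides its value in \<open>S\<close>, the letter of \<open>w\<close>
  read at the same time; so \<open>w\<close> is recovered from its lift, and regularity needs no projection of languages.
  One more letter, for which \<open>w\<close> has none left, is appended at the end. Without it
  the empty word of \<open>L\<close> could be lifted only to the identity, and the other elements of the
  kernel might have no lift.

  Regularity is handled by the Myhill-Nerode criterion: a language is rational iff it has
  finitely many left quotients. It gives the equivalence of the two descriptions of an automatic
  structure: for a rational section, the multiplier languages are rational iff the differences
  \<open>\<pi>(u\<^sub>i)\<inverse> \<pi>(v\<^sub>i)\<close> of equally long prefixes of their pairs form a finite set
  (\<open>automatic_structure_iff_finite_differences\<close>). Finiteness of such sets is preserved under products in \<open>G\<close>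
  and, by finiteness of the kernel, under preimages by \<open>\<phi>\<close>. A difference of two lifts is mapped by \<open>\<phi>\<close>
  to the difference of their underlying words in \<open>L\<close>, corrected by the two bounded offsets
  (\<open>finite_differences_lift\<close>). The bounded reduction property (\<open>synchronous_BRP_lift\<close>) holds for the same
  reason: the image of a lift stays near its underlying word, which fellow travels with every other
  word of \<open>L\<close> for the same element.\<close>

section \<open>Rational languages and left quotients\<close>

definition left_quotient :: "'s list \<Rightarrow> 's list set \<Rightarrow> 's list set" where
  "left_quotient u L = {v. u @ v \<in> L}"

lemma nfa_run_Nil [simp]: "nfa_run T p [] q \<longleftrightarrow> p = q"
  by (auto intro: nfa_run.intros elim: nfa_run.cases)

lemma nfa_run_Cons [simp]: "nfa_run T p (a # w) r \<longleftrightarrow> (\<exists>q. (p, a, q) \<in> T \<and> nfa_run T q w r)"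
  by (auto intro: nfa_run.intros elim: nfa_run.cases)

lemma nfa_run_append: "nfa_run T p (u @ v) r \<longleftrightarrow> (\<exists>q. nfa_run T p u q \<and> nfa_run T q v r)"
  by (induction u arbitrary: p) auto

lemma nfa_run_closed:
  assumes "nfa_run T p w q" "T \<subseteq> Q \<times> \<Sigma> \<times> Q" "p \<in> Q"
  shows "q \<in> Q \<and> w \<in> lists \<Sigma>"
  using assms by (induction rule: nfa_run.induct) auto

text \<open>The quotient by \<open>u\<close> depends only on the set of states that an automaton can be in after reading \<open>u\<close>.\<close>
lemma rational_imp_finite_quotients:
  assumes "rational \<Sigma> L"
  shows "L \<subseteq> lists \<Sigma>" and "finite (range (\<lambda>u. left_quotient u L))"
proof -
  obtain Q :: "nat set" and I F T where QT: "finite Q" "I \<subseteq> Q" "T \<subseteq> Q \<times> \<Sigma> \<times> Q"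
    and L: "L = {w. \<exists>p\<in>I. \<exists>q\<in>F. nfa_run T p w q}"
    using assms unfolding rational_def by blast
  show "L \<subseteq> lists \<Sigma>"
    unfolding L using QT(2,3) nfa_run_closed[of T _ _ _ Q \<Sigma>] by blast
  define reach where "reach u = {q. \<exists>p\<in>I. nfa_run T p u q}" for u
  define accepted where "accepted P = {v. \<exists>p\<in>P. \<exists>q\<in>F. nfa_run T p v q}" for P
  have "reach u \<in> Pow Q" for u
    unfolding reach_def using QT(2,3) nfa_run_closed[of T _ _ _ Q \<Sigma>] by blast
  moreover have "left_quotient u L = accepted (reach u)" for u
    unfolding left_quotient_def L reach_def accepted_def
    by (simp add: nfa_run_append set_eq_iff) blast
  ultimately have "range (\<lambda>u. left_quotient u L) \<subseteq> accepted ` Pow Q" by auto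
  then show "finite (range (\<lambda>u. left_quotient u L))"
    using QT(1) by (meson finite_Pow_iff finite_imageI finite_subset)
qed

text \<open>The quotients themselves are the states of an automaton. It is deterministic because
  the quotient by \<open>u @ [a]\<close> is determined by the quotient by \<open>u\<close>; \<open>enc\<close> numbers the states.\<close>
lemma finite_quotients_imp_rational:
  assumes "L \<subseteq> lists \<Sigma>" and fin: "finite (range (\<lambda>u. left_quotient u L))"
  shows "rational \<Sigma> L"
proof -
  obtain enc :: "'a list set \<Rightarrow> nat"
    where enc: "inj_on enc (range (\<lambda>u. left_quotient u L))"
    using finite_imp_inj_to_nat_seg[OF fin] by metis
  define state where "state u = enc (left_quotient u L)" for u
  define T where "T = {(state u, a, state (u @ [a])) | u a. a \<in> \<Sigma>}"
  have state_eq: "left_quotient u L = left_quotient v L" if "state u = state v" for u v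
    using that enc unfolding state_def inj_on_def by blast
  have state_snoc: "state (u @ [a]) = state (v @ [a])" if "state u = state v" for u v a
    using state_eq[OF that] unfolding state_def left_quotient_def by (simp add: set_eq_iff)
  have run: "nfa_run T (state u) w q \<longleftrightarrow> w \<in> lists \<Sigma> \<and> q = state (u @ w)" for u w q
  proof (induction w arbitrary: u)
    case (Cons a w)
    have "(state u, a, p) \<in> T \<longleftrightarrow> a \<in> \<Sigma> \<and> p = state (u @ [a])" for p
    proof
      assume "(state u, a, p) \<in> T"
      then obtain u' where "state u = state u'" "a \<in> \<Sigma>" "p = state (u' @ [a])"
        unfolding T_def by blast
      then show "a \<in> \<Sigma> \<and> p = state (u @ [a])" using state_snoc by metis
    qed (auto simp: T_def)
    then show ?case by (auto simp: Cons.IH)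
  qed auto
  define F where "F = state ` L"
  have "state w \<in> F \<longleftrightarrow> w \<in> L" for w
  proof
    assume "state w \<in> F"
    then obtain w' where "w' \<in> L" "left_quotient w L = left_quotient w' L"
      unfolding F_def using state_eq by blast
    then have "[] \<in> left_quotient w L" by (simp add: left_quotient_def)
    then show "w \<in> L" by (simp add: left_quotient_def)
  qed (simp add: F_def)
  then have "L = {w. \<exists>p\<in>{state []}. \<exists>q\<in>F. nfa_run T p w q}"
    using run[of "[]"] assms(1) by auto
  moreover have "finite (range state)"
    using finite_imageI[OF fin, of enc] by (simp add: image_image state_def)
  moreover have "F \<subseteq> range state" "T \<subseteq> range state \<times> \<Sigma> \<times> range state"
    unfolding F_def T_def by auto
  ultimately show ?thesis
    unfolding rational_def
    by (intro exI[of _ "range state"] exI[of _ "{state []}"] exI[of _ F] exI[of _ T] conjI) simp_all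
qed

section \<open>Convolutions\<close>
lemma map_filter_append: "List.map_filter f (xs @ ys) = List.map_filter f xs @ List.map_filter f ys"
  by (simp add: List.map_filter_def)

lemma tracks_convolution [simp]:
  "List.map_filter fst (convolution u v) = u" "List.map_filter snd (convolution u v) = v"
  by (induction u v rule: convolution.induct) (auto simp: List.map_filter_def)

lemma take_convolution: "take i (convolution u v) = convolution (take i u) (take i v)"
proof (induction u v arbitrary: i rule: convolution.induct)
  case (2 a u) then show ?case by (cases i) auto
next
  case (3 b v) then show ?case by (cases i) auto
next
  case (4 a u b v) then show ?case by (cases i) auto
qed auto

text \<open>Once one component of a convolution has been padded, it cannot resume. This is the only information
  about \<open>u\<close> and \<open>v\<close>, beyond membership in the language, on which the possible continuations depend.\<close>
lemma convolution_append:
  "convolution u v @ d = convolution (u @ s) (v @ t) \<longleftrightarrow>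
     d = convolution s t \<and> (length u < length v \<longrightarrow> s = []) \<and> (length v < length u \<longrightarrow> t = [])"
proof (induction u v rule: convolution.induct)
  case (2 a u) then show ?case by (cases t) simp_all
next
  case (3 b v) then show ?case by (cases s) simp_all
qed simp_all

lemma convolution_padded:
  "u \<in> lists A \<Longrightarrow> v \<in> lists A \<Longrightarrow> convolution u v \<in> lists (padded_alphabet A)"
  by (induction u v rule: convolution.induct) (auto simp: padded_alphabet_def)


section \<open>Multiplier languages and prefix differences\<close>
lemma (in group) inv_mult_telescope:
  assumes "a \<in> carrier G" "b \<in> carrier G" "c \<in> carrier G"
  shows "(inv a \<otimes> b) \<otimes> (inv b \<otimes> c) = inv a \<otimes> c"
proof -
  have "b \<otimes> (inv b \<otimes> c) = c" using assms by (simp add: m_assoc[symmetric])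
  then show ?thesis using assms by (simp add: m_assoc)
qed

locale word_evaluation = group G for G :: "('g, 'm) monoid_scheme" (structure) +
  fixes A :: "'a set" and \<pi> :: "'a list \<Rightarrow> 'g"
  assumes hom: "\<pi> \<in> hom (free_monoid A) G"
begin

lemma eval_closed [simp, intro]: "u \<in> lists A \<Longrightarrow> \<pi> u \<in> carrier G"
  using hom by (auto simp: hom_def free_monoid_def)

lemma eval_append: "u \<in> lists A \<Longrightarrow> v \<in> lists A \<Longrightarrow> \<pi> (u @ v) = \<pi> u \<otimes> \<pi> v"
  using hom by (auto simp: hom_def free_monoid_def)

lemma eval_Nil [simp]: "\<pi> [] = \<one>"
proof -
  have "\<pi> [] \<otimes> \<pi> [] = \<pi> []" using eval_append[of "[]" "[]"] by simp
  then show ?thesis using eval_closed[of "[]"] by simp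
qed

lemma take_lists: "u \<in> lists A \<Longrightarrow> take i u \<in> lists A"
  by (auto dest: in_set_takeD)

definition multiplier :: "'a list set \<Rightarrow> 'a list \<Rightarrow> ('a option \<times> 'a option) list set" where
  "multiplier L x = {convolution u v | u v. u \<in> L \<and> v \<in> L \<and> \<pi> v = \<pi> (u @ x)}"

text \<open>Finiteness of this set is the fellow traveller property for pairs of words whose values differ by \<open>y\<close>.
  It makes no reference to the word metric.\<close>
definition differences :: "'a list set \<Rightarrow> 'g \<Rightarrow> 'g set" where
  "differences L y = {inv (\<pi> (take i u)) \<otimes> \<pi> (take i v) | u v i. u \<in> L \<and> v \<in> L \<and> \<pi> v = \<pi> u \<otimes> y}"

text \<open>If \<open>d\<close> continues a convolution of two prefixes to a word of the multiplier language, then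
  the values of the two components of \<open>d\<close> determine the difference of the prefixes. Choosing one such \<open>d\<close>
  for each quotient of the language shows that there are no more differences than quotients.\<close>
lemma rational_multiplier_imp_finite_differences:
  assumes L: "L \<subseteq> lists A" and x: "x \<in> lists A"
    and rat: "rational (padded_alphabet A) (multiplier L x)"
  shows "finite (differences L (\<pi> x))"
proof -
  let ?p = "List.map_filter fst" and ?q = "List.map_filter snd"
  let ?val = "\<lambda>d. \<pi> (?p d) \<otimes> \<pi> x \<otimes> inv (\<pi> (?q d))"
  have "differences L (\<pi> x) \<subseteq>
    (\<lambda>X. ?val (SOME d. d \<in> X)) ` range (\<lambda>c. left_quotient c (multiplier L x))"
  proof
    fix g assume "g \<in> differences L (\<pi> x)"
    then obtain u v i where uv: "u \<in> L" "v \<in> L" "\<pi> v = \<pi> u \<otimes> \<pi> x"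
      and g: "g = inv (\<pi> (take i u)) \<otimes> \<pi> (take i v)"
      unfolding differences_def by blast
    define c where "c = take i (convolution u v)"
    define d where "d = (SOME d. d \<in> left_quotient c (multiplier L x))"
    have uv': "u \<in> lists A" "v \<in> lists A" using uv L by auto
    have "convolution u v \<in> multiplier L x"
      unfolding multiplier_def using uv eval_append[OF uv'(1) x]
      by (intro CollectI exI[of _ u] exI[of _ v]) simp
    then have "drop i (convolution u v) \<in> left_quotient c (multiplier L x)"
      unfolding left_quotient_def c_def by simp
    then have "d \<in> left_quotient c (multiplier L x)"
      unfolding d_def by (rule someI)
    then obtain u' v' where c: "c @ d = convolution u' v'" and u'v': "u' \<in> L" "v' \<in> L" "\<pi> v' = \<pi> (u' @ x)"
      unfolding left_quotient_def multiplier_def by blast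
    have u': "u' = take i u @ ?p d" and v': "v' = take i v @ ?q d"
      using arg_cong[OF c, of ?p] arg_cong[OF c, of ?q]
      by (simp_all add: map_filter_append c_def take_convolution)
    have in_lists: "take i u \<in> lists A" "take i v \<in> lists A" "?p d \<in> lists A" "?q d \<in> lists A"
      using u'v'(1,2) L unfolding u' v' by auto
    have "\<pi> (take i v) \<otimes> \<pi> (?q d) = \<pi> (take i u) \<otimes> (\<pi> (?p d) \<otimes> \<pi> x)"
      using u'v'(3) in_lists x unfolding u' v' by (simp add: eval_append m_assoc)
    then have "\<pi> (take i v) = \<pi> (take i u) \<otimes> ?val d"
      using in_lists x by (simp add: inv_solve_right m_assoc[symmetric])
    then have "g = ?val d"
      unfolding g using in_lists x by (simp add: inv_solve_left')
    then show "g \<in> (\<lambda>X. ?val (SOME d. d \<in> X)) ` range (\<lambda>c. left_quotient c (multiplier L x))"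
      unfolding d_def by blast
  qed
  then show ?thesis
    using rational_imp_finite_quotients(2)[OF rat] by (meson finite_imageI finite_subset)
qed

text \<open>The continuations of a convolution of prefixes \<open>u\<close>, \<open>v\<close> to a word of the multiplier language
  are determined by finitely many data: which prefix is shorter, hence already padded, the
  quotients of \<open>L\<close> by \<open>u\<close> and by \<open>v\<close>, and the difference of the two values. The function \<open>rest\<close>
  below computes the continuations from these data.\<close>
lemma finite_differences_imp_rational_multiplier:
  assumes rat: "rational A L" and x: "x \<in> lists A" and fin: "finite (differences L (\<pi> x))"
  shows "rational (padded_alphabet A) (multiplier L x)"
proof (rule finite_quotients_imp_rational)
  let ?p = "List.map_filter fst" and ?q = "List.map_filter snd"
  let ?Q = "range (\<lambda>u. left_quotient u L)"
  have L: "L \<subseteq> lists A" by (rule rational_imp_finite_quotients(1)[OF rat])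
  then have "convolution u v \<in> lists (padded_alphabet A)" if "u \<in> L" "v \<in> L" for u v
    by (intro convolution_padded) (use that in auto)
  then show "multiplier L x \<subseteq> lists (padded_alphabet A)"
    unfolding multiplier_def by blast
  define rest where "rest = (\<lambda>(shorter1, shorter2, X, Y, g). {d. d = convolution (?p d) (?q d) \<and>
      (shorter1 \<longrightarrow> ?p d = []) \<and> (shorter2 \<longrightarrow> ?q d = []) \<and> ?p d \<in> X \<and> ?q d \<in> Y \<and>
      ?p d \<in> lists A \<and> ?q d \<in> lists A \<and> g \<otimes> \<pi> (?q d) = \<pi> (?p d) \<otimes> \<pi> x})"
  have "left_quotient c (multiplier L x) \<in>
    insert {} (rest ` (UNIV \<times> UNIV \<times> ?Q \<times> ?Q \<times> differences L (\<pi> x)))" for c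
  proof (cases "left_quotient c (multiplier L x) = {}")
    case False
    then obtain d\<^sub>0 u\<^sub>0 v\<^sub>0 where c0: "c @ d\<^sub>0 = convolution u\<^sub>0 v\<^sub>0"
      and uv0: "u\<^sub>0 \<in> L" "v\<^sub>0 \<in> L" "\<pi> v\<^sub>0 = \<pi> (u\<^sub>0 @ x)"
      unfolding left_quotient_def multiplier_def by blast
    define u v where "u = take (length c) u\<^sub>0" and "v = take (length c) v\<^sub>0"
    define g where "g = inv (\<pi> u) \<otimes> \<pi> v"
    have c: "c = convolution u v"
      unfolding u_def v_def using arg_cong[OF c0, of "take (length c)"] by (simp add: take_convolution)
    have uv0': "u\<^sub>0 \<in> lists A" "v\<^sub>0 \<in> lists A" using uv0 L by auto
    then have uv: "u \<in> lists A" "v \<in> lists A" unfolding u_def v_def by (simp_all only: take_lists)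
    have g: "g \<in> differences L (\<pi> x)"
      unfolding differences_def g_def u_def v_def using uv0 eval_append[OF uv0'(1) x] by auto
    have "d \<in> left_quotient c (multiplier L x) \<longleftrightarrow>
       d \<in> rest (length u < length v, length v < length u, left_quotient u L, left_quotient v L, g)"
      (is "?lhs \<longleftrightarrow> ?rhs") for d
    proof -
      have split: "c @ d = convolution u' v' \<longleftrightarrow> u' = u @ ?p d \<and> v' = v @ ?q d \<and>
          d = convolution (?p d) (?q d) \<and>
          (length u < length v \<longrightarrow> ?p d = []) \<and> (length v < length u \<longrightarrow> ?q d = [])" for u' v'
      proof
        assume eq: "c @ d = convolution u' v'"
        have "u' = u @ ?p d" "v' = v @ ?q d"
          using arg_cong[OF eq, of ?p] arg_cong[OF eq, of ?q] by (simp_all add: map_filter_append c)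
        moreover from this have "convolution u v @ d = convolution (u @ ?p d) (v @ ?q d)"
          using eq c by simp
        ultimately show "u' = u @ ?p d \<and> v' = v @ ?q d \<and> d = convolution (?p d) (?q d) \<and>
          (length u < length v \<longrightarrow> ?p d = []) \<and> (length v < length u \<longrightarrow> ?q d = [])"
          unfolding convolution_append by blast
      qed (auto simp: c convolution_append)
      have eqn: "\<pi> (v @ t) = \<pi> (u @ s @ x) \<longleftrightarrow> g \<otimes> \<pi> t = \<pi> s \<otimes> \<pi> x"
        if "s \<in> lists A" "t \<in> lists A" for s t
      proof -
        have "g \<otimes> \<pi> t = inv (\<pi> u) \<otimes> (\<pi> v \<otimes> \<pi> t)"
          unfolding g_def using that uv by (simp add: m_assoc)
        then have "g \<otimes> \<pi> t = \<pi> s \<otimes> \<pi> x \<longleftrightarrow> \<pi> v \<otimes> \<pi> t = \<pi> u \<otimes> (\<pi> s \<otimes> \<pi> x)"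
          using that uv x by (simp add: inv_solve_left')
        then show ?thesis using that uv x by (simp add: eval_append)
      qed
      have "?lhs \<longleftrightarrow> (\<exists>u' v'. c @ d = convolution u' v' \<and> u' \<in> L \<and> v' \<in> L \<and> \<pi> v' = \<pi> (u' @ x))"
        by (simp add: left_quotient_def multiplier_def)
      also have "\<dots> \<longleftrightarrow> d = convolution (?p d) (?q d) \<and>
          (length u < length v \<longrightarrow> ?p d = []) \<and> (length v < length u \<longrightarrow> ?q d = []) \<and>
          u @ ?p d \<in> L \<and> v @ ?q d \<in> L \<and> \<pi> (v @ ?q d) = \<pi> (u @ ?p d @ x)"
        unfolding split by (metis append.assoc)
      also have "\<dots> \<longleftrightarrow> ?rhs"
      proof -
        have "?p d \<in> lists A" if "u @ ?p d \<in> L" using that L by auto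
        moreover have "?q d \<in> lists A" if "v @ ?q d \<in> L" using that L by auto
        ultimately show ?thesis
          unfolding rest_def prod.case mem_Collect_eq left_quotient_def using eqn by blast
      qed
      finally show ?thesis .
    qed
    then have "left_quotient c (multiplier L x) =
       rest (length u < length v, length v < length u, left_quotient u L, left_quotient v L, g)"
      by blast
    then show ?thesis using g by blast
  qed simp
  then have "range (\<lambda>c. left_quotient c (multiplier L x)) \<subseteq>
    insert {} (rest ` (UNIV \<times> UNIV \<times> ?Q \<times> ?Q \<times> differences L (\<pi> x)))" by blast
  moreover have "finite \<dots>"
    using fin rational_imp_finite_quotients(2)[OF rat] by simp
  ultimately show "finite (range (\<lambda>c. left_quotient c (multiplier L x)))"
    by (rule finite_subset)
qed

lemma automatic_structure_iff_finite_differences: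
  "automatic_structure G A \<pi> L \<longleftrightarrow>
     generating_hom G A \<pi> \<and> is_section G A \<pi> L \<and> rational A L \<and>
     (\<forall>x \<in> insert [] ((\<lambda>a. [a]) ` A). finite (differences L (\<pi> x)))"
proof -
  have "rational (padded_alphabet A) (multiplier L x) \<longleftrightarrow> finite (differences L (\<pi> x))"
    if "rational A L" "x \<in> insert [] ((\<lambda>a. [a]) ` A)" for x
    using that rational_multiplier_imp_finite_differences[of L x]
      finite_differences_imp_rational_multiplier[of L x] rational_imp_finite_quotients(1)[of A L]
    by auto
  then show ?thesis unfolding automatic_structure_def multiplier_def by blast
qed

text \<open>A general \<open>y\<close> is spelled out in letters; the words of \<open>L\<close> for the intermediate elements
  form a chain from \<open>u\<close> to \<open>v\<close>, and the differences along the chain multiply.\<close>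
lemma automatic_structure_finite_differences:
  assumes aut: "automatic_structure G A \<pi> L" and y: "y \<in> carrier G"
  shows "finite (differences L y)"
proof -
  have letters: "finite (differences L (\<pi> x))" if "x \<in> insert [] ((\<lambda>a. [a]) ` A)" for x
    using aut that unfolding automatic_structure_iff_finite_differences by blast
  have L: "L \<subseteq> lists A" "\<pi> ` L = carrier G"
    using aut unfolding automatic_structure_def is_section_def by auto
  have "finite (differences L (\<pi> w))" if "w \<in> lists A" for w
    using that
  proof (induction w rule: rev_induct)
    case Nil
    then show ?case using letters by blast
  next
    case (snoc a w)
    then have a: "[a] \<in> lists A" "w \<in> lists A" by auto
    have "differences L (\<pi> (w @ [a])) \<subseteq>
      (\<lambda>(d, e). d \<otimes> e) ` (differences L (\<pi> w) \<times> differences L (\<pi> [a]))"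
    proof
      fix g assume "g \<in> differences L (\<pi> (w @ [a]))"
      then obtain u v i where uv: "u \<in> L" "v \<in> L" "\<pi> v = \<pi> u \<otimes> \<pi> (w @ [a])"
        and g: "g = inv (\<pi> (take i u)) \<otimes> \<pi> (take i v)"
        unfolding differences_def by blast
      have "\<pi> u \<otimes> \<pi> w \<in> \<pi> ` L" using uv(1) L a by auto
      then obtain t where t: "t \<in> L" "\<pi> t = \<pi> u \<otimes> \<pi> w" by auto
      have uvt: "u \<in> lists A" "v \<in> lists A" "t \<in> lists A" using uv t L by auto
      have "\<pi> v = \<pi> t \<otimes> \<pi> [a]"
        using uv t uvt a by (simp add: eval_append m_assoc)
      then have "inv (\<pi> (take i t)) \<otimes> \<pi> (take i v) \<in> differences L (\<pi> [a])"
        and "inv (\<pi> (take i u)) \<otimes> \<pi> (take i t) \<in> differences L (\<pi> w)"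
        using uv t unfolding differences_def by blast+
      moreover have "g = (inv (\<pi> (take i u)) \<otimes> \<pi> (take i t)) \<otimes> (inv (\<pi> (take i t)) \<otimes> \<pi> (take i v))"
        unfolding g using uvt[THEN take_lists, of i] by (simp add: inv_mult_telescope)
      ultimately show "g \<in> (\<lambda>(d, e). d \<otimes> e) ` (differences L (\<pi> w) \<times> differences L (\<pi> [a]))"
        by (intro image_eqI[OF _ SigmaI]) simp_all
    qed
    moreover have "finite (differences L (\<pi> w) \<times> differences L (\<pi> [a]))"
      using snoc.IH a letters by auto
    ultimately show ?case by (meson finite_imageI finite_subset)
  qed
  moreover have "y \<in> \<pi> ` L" using L(2) y by simp
  then obtain w where "w \<in> L" "\<pi> w = y" by (elim imageE) simp
  ultimately show ?thesis using L(1) by auto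
qed

section \<open>Word metric and finite sets of group elements\<close>
abbreviation edges :: "'g rel" where
  "edges \<equiv> cayley_edges G A \<pi> \<union> (cayley_edges G A \<pi>)\<inverse>"

lemma finite_relpow_edges:
  assumes "finite A"
  shows "finite {inv g \<otimes> h | g h. g \<in> carrier G \<and> h \<in> carrier G \<and> (g, h) \<in> edges ^^ n}"
proof (induction n)
  case 0
  have "{inv g \<otimes> h | g h. g \<in> carrier G \<and> h \<in> carrier G \<and> (g, h) \<in> edges ^^ 0} \<subseteq> {\<one>}" by auto
  then show ?case by (rule finite_subset) simp
next
  case (Suc n)
  let ?B = "\<lambda>n. {inv g \<otimes> h | g h. g \<in> carrier G \<and> h \<in> carrier G \<and> (g, h) \<in> edges ^^ n}"
  define S where "S = (\<lambda>a. \<pi> [a]) ` A \<union> (\<lambda>a. inv (\<pi> [a])) ` A"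
  have step: "k \<in> carrier G \<and> inv k \<otimes> h \<in> S" if "(k, h) \<in> edges" "h \<in> carrier G" for k h
  proof -
    consider a where "k \<in> carrier G" "a \<in> A" "h = k \<otimes> \<pi> [a]"
      | a where "h \<in> carrier G" "a \<in> A" "k = h \<otimes> \<pi> [a]"
      using \<open>(k, h) \<in> edges\<close> unfolding cayley_edges_def by blast
    then show ?thesis
    proof cases
      case 1
      then have "inv k \<otimes> h = \<pi> [a]" by (simp add: inv_solve_left')
      then show ?thesis using 1 unfolding S_def by blast
    next
      case 2
      then have "inv k \<otimes> h = inv (\<pi> [a])" by (simp add: inv_mult_group m_assoc)
      then show ?thesis using 2 unfolding S_def by auto
    qed
  qed
  have "?B (Suc n) \<subseteq> (\<lambda>(b, s). b \<otimes> s) ` (?B n \<times> S)"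
  proof
    fix r assume "r \<in> ?B (Suc n)"
    then obtain g h k where gh: "g \<in> carrier G" "h \<in> carrier G" "(g, k) \<in> edges ^^ n" "(k, h) \<in> edges"
      and r: "r = inv g \<otimes> h" by auto
    have k: "k \<in> carrier G" "inv k \<otimes> h \<in> S" using step gh by auto
    have "r = (inv g \<otimes> k) \<otimes> (inv k \<otimes> h)"
      unfolding r using gh k by (simp add: inv_mult_telescope)
    moreover have "inv g \<otimes> k \<in> ?B n" using gh k by blast
    ultimately show "r \<in> (\<lambda>(b, s). b \<otimes> s) ` (?B n \<times> S)" using k by blast
  qed
  moreover have "finite S" unfolding S_def using assms by simp
  ultimately show ?case
    by (rule finite_subset[OF _ finite_imageI[OF finite_cartesian_product[OF Suc]]])
qed

lemma relpow_edges_eval: "g \<in> carrier G \<Longrightarrow> u \<in> lists A \<Longrightarrow> (g, g \<otimes> \<pi> u) \<in> edges ^^ length u"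
proof (induction u arbitrary: g)
  case (Cons a u)
  then have a: "[a] \<in> lists A" "u \<in> lists A" by auto
  have "(g, g \<otimes> \<pi> [a]) \<in> edges" using Cons.prems a unfolding cayley_edges_def by auto
  moreover have "(g \<otimes> \<pi> [a], g \<otimes> \<pi> [a] \<otimes> \<pi> u) \<in> edges ^^ length u"
    using Cons.IH[of "g \<otimes> \<pi> [a]"] Cons.prems a by auto
  ultimately have "(g, g \<otimes> \<pi> [a] \<otimes> \<pi> u) \<in> edges ^^ Suc (length u)"
    by (rule relpow_Suc_I2)
  moreover have "g \<otimes> \<pi> (a # u) = g \<otimes> \<pi> [a] \<otimes> \<pi> u"
    using eval_append[OF a] Cons.prems a by (simp add: m_assoc)
  ultimately show ?case by (simp only: list.size(4) add_0_right add_Suc_right)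
qed simp

lemma word_dist_le_length:
  "g \<in> carrier G \<Longrightarrow> u \<in> lists A \<Longrightarrow> word_dist G A \<pi> g (g \<otimes> \<pi> u) \<le> length u"
  unfolding word_dist_def by (rule Least_le) (rule relpow_edges_eval)

text \<open>This and the next lemma translate between bounds on the word metric and finite sets of
  differences.\<close>
lemma word_dist_bounded_on_finite:
  assumes surj: "carrier G \<subseteq> \<pi> ` lists A" and R: "finite R" "R \<subseteq> carrier G"
  obtains N where "\<And>g r. g \<in> carrier G \<Longrightarrow> r \<in> R \<Longrightarrow> word_dist G A \<pi> g (g \<otimes> r) \<le> N"
proof -
  have "\<forall>r\<in>R. \<exists>u. u \<in> lists A \<and> \<pi> u = r" using surj R(2) by blast
  then obtain rep where rep: "\<And>r. r \<in> R \<Longrightarrow> rep r \<in> lists A \<and> \<pi> (rep r) = r" by metis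
  show thesis
  proof (rule that)
    fix g r assume "g \<in> carrier G" "r \<in> R"
    then have "word_dist G A \<pi> g (g \<otimes> r) \<le> length (rep r)"
      using word_dist_le_length[of g "rep r"] rep[of r] by simp
    also have "\<dots> \<le> (\<Sum>r\<in>R. length (rep r))" 
      using R(1) \<open>r \<in> R\<close> by (intro member_le_sum) auto
    finally show "word_dist G A \<pi> g (g \<otimes> r) \<le> (\<Sum>r\<in>R. length (rep r))" .
  qed
qed

lemma finite_word_ball:
  assumes surj: "carrier G \<subseteq> \<pi> ` lists A" and "finite A"
  shows "finite {inv g \<otimes> h | g h. g \<in> carrier G \<and> h \<in> carrier G \<and> word_dist G A \<pi> g h \<le> N}"
proof -
  have "(g, h) \<in> edges ^^ word_dist G A \<pi> g h" if gh: "g \<in> carrier G" "h \<in> carrier G" for g h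
  proof -
    have "inv g \<otimes> h \<in> \<pi> ` lists A" using surj gh by (intro subsetD[OF surj]) simp
    then obtain u where u: "u \<in> lists A" "\<pi> u = inv g \<otimes> h" by (elim imageE) simp
    then have "g \<otimes> \<pi> u = h" using gh by (simp add: m_assoc[symmetric])
    then have "(g, h) \<in> edges ^^ length u" using relpow_edges_eval[OF gh(1) u(1)] by simp
    then show ?thesis unfolding word_dist_def by (rule LeastI)
  qed
  then have "{inv g \<otimes> h | g h. g \<in> carrier G \<and> h \<in> carrier G \<and> word_dist G A \<pi> g h \<le> N} \<subseteq>
    (\<Union>n\<le>N. {inv g \<otimes> h | g h. g \<in> carrier G \<and> h \<in> carrier G \<and> (g, h) \<in> edges ^^ n})" by blast
  then show ?thesis by (rule finite_subset) (use finite_relpow_edges assms(2) in blast)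
qed

end

lemma (in group) finite_vimage_of_finite_kernel:
  assumes \<phi>: "\<phi> \<in> hom G G" and ker: "finite (kernel G G \<phi>)" and S: "finite S"
  shows "finite {g \<in> carrier G. \<phi> g \<in> S}"
proof -
  interpret \<phi>: group_hom G G \<phi> using \<phi> by unfold_locales
  have "finite {g \<in> carrier G. \<phi> g = s}" for s
  proof (cases "\<exists>g\<^sub>0\<in>carrier G. \<phi> g\<^sub>0 = s")
    case True
    then obtain g\<^sub>0 where g0: "g\<^sub>0 \<in> carrier G" "\<phi> g\<^sub>0 = s" by blast
    have s: "s \<in> carrier G" using g0 by auto
    have "g \<in> (\<lambda>k. g\<^sub>0 \<otimes> k) ` kernel G G \<phi>" if "g \<in> carrier G" "\<phi> g = s" for g
    proof (rule image_eqI)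
      show "g = g\<^sub>0 \<otimes> (inv g\<^sub>0 \<otimes> g)" using that g0 by (simp add: m_assoc[symmetric])
      show "inv g\<^sub>0 \<otimes> g \<in> kernel G G \<phi>" using that g0 s by (simp add: kernel_def)
    qed
    then have "{g \<in> carrier G. \<phi> g = s} \<subseteq> (\<lambda>k. g\<^sub>0 \<otimes> k) ` kernel G G \<phi>" by blast
    then show ?thesis by (rule finite_subset) (rule finite_imageI[OF ker])
  next
    case False
    then have "{g \<in> carrier G. \<phi> g = s} = {}" by blast
    then show ?thesis by (simp only: finite.emptyI)
  qed
  moreover have "{g \<in> carrier G. \<phi> g \<in> S} = (\<Union>s\<in>S. {g \<in> carrier G. \<phi> g = s})" by blast
  ultimately show ?thesis using S by simp
qed

section \<open>Lifting a language along an endomorphism\<close>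
lemma map_filter_id_take: "List.map_filter id (take i (map Some w @ [None])) = take i w"
proof -
  have "List.map_filter id (map Some w') = w'" for w' :: "'a list"
    by (induction w') simp_all
  moreover have "List.map_filter id (take n [None]) = []" for n
    by (cases n) simp_all
  ultimately show ?thesis by (simp add: map_filter_append take_map)
qed

text \<open>Here \<open>None\<close> marks the extra last letter of a lift, which reads no letter of the underlying word.\<close>
lemma finite_quotients_image_map_Some:
  assumes "finite (range (\<lambda>u. left_quotient u L))"
  shows "finite (range (\<lambda>u. left_quotient u ((\<lambda>w. map Some w @ [None]) ` L)))"
proof -
  let ?f = "\<lambda>w. map Some w @ [None]"
  have "left_quotient c (?f ` L) \<in> {{}, {[]}} \<union> (\<lambda>X. ?f ` X) ` range (\<lambda>u. left_quotient u L)" for c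
  proof (cases "\<exists>u. c = map Some u")
    case True
    then obtain u where c: "c = map Some u" by blast
    have "left_quotient c (?f ` L) = ?f ` left_quotient u L"
    proof (intro subset_antisym subsetI)
      fix d assume "d \<in> left_quotient c (?f ` L)"
      then obtain w where w: "w \<in> L" "map Some u @ d = map Some w @ [None]"
        unfolding left_quotient_def c by auto
      have "length u \<le> length w"
      proof (rule ccontr)
        assume "\<not> length u \<le> length w"
        then have "(map Some u @ d) ! length w = Some (u ! length w)" by (simp add: nth_append)
        moreover have "(map Some w @ [None]) ! length w = None" by (simp add: nth_append)
        ultimately show False using w(2) by (metis option.distinct(1))
      qed
      then have "map Some u = map Some (take (length u) w)" "d = map Some (drop (length u) w) @ [None]"
        using arg_cong[OF w(2), of "take (length u)"] arg_cong[OF w(2), of "drop (length u)"]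
        by (simp_all add: take_map drop_map)
      moreover from this have "u = take (length u) w"
        by (metis inj_map_eq_map inj_Some)
      ultimately show "d \<in> ?f ` left_quotient u L"
        unfolding left_quotient_def using w(1) by (intro image_eqI) (simp, metis append_take_drop_id mem_Collect_eq)
    next
      fix d assume "d \<in> ?f ` left_quotient u L"
      then show "d \<in> left_quotient c (?f ` L)"
        unfolding left_quotient_def c by (auto intro!: image_eqI[of _ _ "u @ _"])
    qed
    then show ?thesis by blast
  next
    case False
    have "d = []" if "d \<in> left_quotient c (?f ` L)" for d
    proof (rule ccontr)
      assume "d \<noteq> []"
      from that obtain w where "c @ d = map Some w @ [None]"
        unfolding left_quotient_def by auto
      then have "c @ butlast d = map Some w" using \<open>d \<noteq> []\<close> by (metis butlast_append butlast_snoc)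
      then have "c = map Some (take (length c) w)" by (metis append_eq_conv_conj take_map)
      then show False using False by blast
    qed
    then have "left_quotient c (?f ` L) \<subseteq> {[]}" by blast
    then show ?thesis by (simp add: subset_singleton_iff) blast
  qed
  then have "range (\<lambda>c. left_quotient c (?f ` L)) \<subseteq>
    {{}, {[]}} \<union> (\<lambda>X. ?f ` X) ` range (\<lambda>u. left_quotient u L)" by blast
  then show ?thesis by (rule finite_subset) (simp add: assms)
qed

text \<open>The set \<open>R\<close> contains the allowed offsets from a prefix of a word of \<open>L\<close> to a nearby point of
  the image of \<open>\<phi>\<close>. A letter \<open>c\<close> of the new alphabet stands for the pair of its value \<open>val c\<close> in \<open>G\<close> and the
  letter \<open>tr c\<close> of the underlying word, or \<open>None\<close>. The values are the elements whose images lead from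
  one point near the path of the underlying word to another one, while that path makes at most one step. The letters
  have an abstract type so that they may be numbered later.\<close>
locale lifted_language = word_evaluation G A \<pi>
  for G :: "('g, 'm) monoid_scheme" (structure) and A :: "'a set" and \<pi> +
  fixes L :: "'a list set" and \<phi> :: "'g \<Rightarrow> 'g" and R :: "'g set"
    and A' :: "'c set" and val :: "'c \<Rightarrow> 'g" and tr :: "'c \<Rightarrow> 'a option"
  assumes aut: "automatic_structure G A \<pi> L"
    and endo: "\<phi> \<in> hom G G" and finite_ker: "finite (kernel G G \<phi>)"
    and R: "finite R" "R \<subseteq> carrier G" "\<one> \<in> R"
    and near_image: "\<And>w i. w \<in> L \<Longrightarrow> \<pi> w \<in> \<phi> ` carrier G \<Longrightarrow>
          \<exists>k\<in>carrier G. inv (\<pi> (take i w)) \<otimes> \<phi> k \<in> R"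
    and finite_A': "finite A'"
    and letters: "(\<lambda>c. (val c, tr c)) ` A' =
          {b \<in> carrier G. \<exists>r\<in>R. \<exists>s\<in>insert \<one> ((\<lambda>a. \<pi> [a]) ` A). \<exists>r'\<in>R. \<phi> b = inv r \<otimes> s \<otimes> r'} \<times>
          insert None (Some ` A)"
begin

sublocale \<phi>: group_hom G G \<phi>
  using endo by unfold_locales

definition val_word :: "'c list \<Rightarrow> 'g" where
  "val_word u = foldr (\<lambda>c g. val c \<otimes> g) u \<one>"

definition trace :: "'c list \<Rightarrow> 'a list" where
  "trace u = List.map_filter tr u"

definition offset :: "'c list \<Rightarrow> 'g" where
  "offset u = inv (\<pi> (trace u)) \<otimes> \<phi> (val_word u)"

definition lift :: "'c list set" where
  "lift = {u \<in> lists A'. map tr u \<in> (\<lambda>w. map Some w @ [None]) ` L \<and>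
     (\<forall>i. offset (take i u) \<in> R) \<and> offset u = \<one>}"

lemma letter: "c \<in> A' \<Longrightarrow> val c \<in> carrier G" "c \<in> A' \<Longrightarrow> tr c \<in> insert None (Some ` A)"
  using letters by blast+

lemma val_word_closed: "u \<in> lists A' \<Longrightarrow> val_word u \<in> carrier G"
  by (induction u) (auto simp: val_word_def letter)

lemma val_word_append:
  "u \<in> lists A' \<Longrightarrow> v \<in> lists A' \<Longrightarrow> val_word (u @ v) = val_word u \<otimes> val_word v"
proof (induction u)
  case Nil
  then show ?case using val_word_closed by (simp add: val_word_def)
next
  case (Cons c u)
  then have "val_word ((c # u) @ v) = val c \<otimes> (val_word u \<otimes> val_word v)"
    by (simp add: val_word_def)
  also have "\<dots> = (val c \<otimes> val_word u) \<otimes> val_word v"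
    using Cons.prems val_word_closed letter(1) by (intro m_assoc[symmetric]) auto
  finally show ?case by (simp add: val_word_def)
qed

sublocale lifted: word_evaluation G A' val_word
  by unfold_locales (auto simp: hom_def free_monoid_def val_word_closed val_word_append)

lemma L_section: "L \<subseteq> lists A" "\<pi> ` L = carrier G" "finite A"
  using aut unfolding automatic_structure_def is_section_def generating_hom_def by auto

lemma trace_closed: "u \<in> lists A' \<Longrightarrow> trace u \<in> lists A"
proof (induction u)
  case (Cons c u)
  then show ?case using letter(2)[of c] by (auto simp: trace_def)
qed (simp add: trace_def)

lemma trace_append: "trace (u @ v) = trace u @ trace v"
  by (simp add: trace_def map_filter_append)

lemma trace_take:
  assumes "map tr u = map Some w @ [None]"
  shows "trace (take i u) = take i w"
proof -
  have "trace v = List.map_filter id (map tr v)" for v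
    by (induction v) (simp_all add: trace_def split: option.split)
  then have "trace (take i u) = List.map_filter id (take i (map tr u))" by (simp add: take_map)
  then show ?thesis unfolding assms map_filter_id_take .
qed

lemma trace_eq:
  assumes "map tr u = map Some w @ [None]"
  shows "trace u = w"
proof -
  have "length u = Suc (length w)" using arg_cong[OF assms, of length] by simp
  then show ?thesis using trace_take[OF assms, of "length u"] by simp
qed

text \<open>The form in which lifts are compared with one another and with words of \<open>L\<close>: differences of
  prefixes of lifts reduce to differences of prefixes of underlying words, up to elements of \<open>R\<close>.\<close>
lemma lift_traceE:
  assumes "u \<in> lift"
  obtains w where "w \<in> L" "\<pi> w = \<phi> (val_word u)" "\<And>i. trace (take i u) = take i w"
    "\<And>i. inv (\<pi> (take i w)) \<otimes> \<phi> (val_word (take i u)) \<in> R"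
proof -
  obtain w where w: "w \<in> L" "map tr u = map Some w @ [None]"
    and u: "u \<in> lists A'" "offset u = \<one>" "\<And>i. offset (take i u) \<in> R"
    using assms unfolding lift_def by blast
  have "w \<in> lists A" using w L_section by auto
  then have "\<pi> w = \<phi> (val_word u)"
    using u(1,2) unfolding offset_def trace_eq[OF w(2)] by (simp add: inv_solve_left')
  then show thesis
    using that[of w] w u(3) trace_take[OF w(2)] unfolding offset_def by simp
qed

lemma offset_closed: "u \<in> lists A' \<Longrightarrow> offset u \<in> carrier G"
  using trace_closed unfolding offset_def by simp

lemma offset_append:
  assumes "u \<in> lists A'" "v \<in> lists A'"
  shows "offset (u @ v) = inv (\<pi> (trace v)) \<otimes> offset u \<otimes> \<phi> (val_word v)"
  using assms[THEN trace_closed] assms unfolding offset_def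
  by (simp add: trace_append eval_append lifted.eval_append inv_mult_group m_assoc)

text \<open>The lifts that extend \<open>u\<close> depend on the quotient of the underlying language and on the
  offset of \<open>u\<close>, which lies in the finite set \<open>R\<close> if there is any such lift.\<close>
lemma rational_lift: "rational A' lift"
proof (rule finite_quotients_imp_rational)
  show "lift \<subseteq> lists A'" unfolding lift_def by blast
  let ?P = "(\<lambda>w. map Some w @ [None]) ` L"
  let ?Q = "range (\<lambda>u. left_quotient u ?P)"
  define rest where "rest = (\<lambda>(X, r). {v \<in> lists A'. map tr v \<in> X \<and>
      (\<forall>j. inv (\<pi> (trace (take j v))) \<otimes> r \<otimes> \<phi> (val_word (take j v)) \<in> R) \<and>
      inv (\<pi> (trace v)) \<otimes> r \<otimes> \<phi> (val_word v) = \<one>})"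
  have "left_quotient u lift \<in> insert {} (rest ` (?Q \<times> R))" for u
  proof (cases "left_quotient u lift = {}")
    case False
    then obtain v\<^sub>0 where "u @ v\<^sub>0 \<in> lift" unfolding left_quotient_def by blast
    then have u: "u \<in> lists A'" and u_near: "\<And>i. offset (take i (u @ v\<^sub>0)) \<in> R"
      unfolding lift_def by auto
    have u_near: "offset (take i u) \<in> R" for i
      using u_near[of "min i (length u)"] by (simp add: min_def split: if_splits)
    have "v \<in> left_quotient u lift \<longleftrightarrow> v \<in> rest (left_quotient (map tr u) ?P, offset u)" for v
    proof (cases "v \<in> lists A'")
      case v: True
      have "(\<forall>i. offset (take i (u @ v)) \<in> R) \<longleftrightarrow> (\<forall>j. offset (u @ take j v) \<in> R)"
      proof (intro iffI allI)
        fix j assume "\<forall>i. offset (take i (u @ v)) \<in> R"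
        from spec[OF this, of "length u + j"] show "offset (u @ take j v) \<in> R" by simp
      next
        fix i assume *: "\<forall>j. offset (u @ take j v) \<in> R"
        show "offset (take i (u @ v)) \<in> R"
        proof (cases "i \<le> length u")
          case True
          then show ?thesis using u_near[of i] by simp
        next
          case False
          then show ?thesis using spec[OF *, of "i - length u"] by simp
        qed
      qed
      moreover have "offset (u @ take j v) =
          inv (\<pi> (trace (take j v))) \<otimes> offset u \<otimes> \<phi> (val_word (take j v))" for j
        by (rule offset_append[OF u lifted.take_lists[OF v]])
      moreover have "u @ v \<in> lists A'" using u v by simp
      ultimately show ?thesis
        using v unfolding left_quotient_def lift_def rest_def prod.case mem_Collect_eq
        by (simp only: offset_append[OF u v] map_append simp_thms)
    next
      case False
      then show ?thesis unfolding left_quotient_def lift_def rest_def by auto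
    qed
    then have "left_quotient u lift = rest (left_quotient (map tr u) ?P, offset u)" by blast
    moreover have "offset u \<in> R" using u_near[of "length u"] by simp
    ultimately show ?thesis by blast
  qed simp
  then have "range (\<lambda>u. left_quotient u lift) \<subseteq> insert {} (rest ` (?Q \<times> R))" by blast
  moreover have "finite ?Q"
    using aut unfolding automatic_structure_def
    by (intro finite_quotients_image_map_Some rational_imp_finite_quotients(2)) blast
  ultimately show "finite (range (\<lambda>u. left_quotient u lift))"
    using R(1) by (meson finite_SigmaI finite_imageI finite_insert finite_subset)
qed

text \<open>For a word \<open>w \<in> L\<close> representing \<open>\<phi> g\<close>, the points \<open>k i\<close> start at the identity, follow \<open>w\<close> up to its
  length \<open>n\<close>, and end at \<open>k (n + 1) = g\<close> itself. The last letter thus corrects both the remaining offset and the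
  choice of preimage of \<open>\<phi> g\<close>.\<close>
lemma lift_surj:
  assumes g: "g \<in> carrier G"
  shows "g \<in> val_word ` lift"
proof -
  have "\<phi> g \<in> \<pi> ` L" using g L_section(2) by simp
  then obtain w where w: "w \<in> L" "\<pi> w = \<phi> g" by (elim imageE) simp
  define n where "n = length w"
  have wA: "w \<in> lists A" using w L_section(1) by auto
  have "\<forall>i. \<exists>k. k \<in> carrier G \<and> inv (\<pi> (take i w)) \<otimes> \<phi> k \<in> R"
    using near_image[OF w(1)] w(2) g by blast
  then obtain k\<^sub>0 where k0: "\<And>i. k\<^sub>0 i \<in> carrier G" "\<And>i. inv (\<pi> (take i w)) \<otimes> \<phi> (k\<^sub>0 i) \<in> R"
    by metis
  define k where "k i = (if i = 0 then \<one> else if i \<le> n then k\<^sub>0 i else g)" for i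
  have k: "k i \<in> carrier G" for i using k0 g unfolding k_def by simp
  define r where "r i = inv (\<pi> (take i w)) \<otimes> \<phi> (k i)" for i
  have r: "r i \<in> R" for i
  proof -
    have "inv (\<pi> w) \<otimes> \<phi> g = \<one>" using w(2) g by simp
    then show ?thesis using k0(2)[of i] R(3) unfolding r_def k_def n_def by simp
  qed
  define s where "s i = inv (\<pi> (take i w)) \<otimes> \<pi> (take (Suc i) w)" for i
  have s: "s i \<in> insert \<one> ((\<lambda>a. \<pi> [a]) ` A)" for i
  proof (cases "i < n")
    case True
    then have "take (Suc i) w = take i w @ [w ! i]" "w ! i \<in> A"
      using wA by (auto simp: n_def take_Suc_conv_app_nth)
    then have "s i = \<pi> [w ! i]"
      unfolding s_def using take_lists[OF wA, of i] by (simp add: eval_append m_assoc[symmetric])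
    then show ?thesis using \<open>w ! i \<in> A\<close> by simp
  next
    case False
    then show ?thesis unfolding s_def using wA by (simp add: n_def)
  qed
  define b where "b i = inv (k i) \<otimes> k (Suc i)" for i
  define out where "out i = (if i < n then Some (w ! i) else None)" for i
  have "\<exists>c. c \<in> A' \<and> val c = b i \<and> tr c = out i" for i
  proof -
    have wi: "\<pi> (take j w) \<in> carrier G" for j using take_lists[OF wA] by simp
    have "inv (r i) = inv (\<phi> (k i)) \<otimes> \<pi> (take i w)"
      unfolding r_def using k wi by (simp add: inv_mult_group)
    then have "inv (r i) \<otimes> s i \<otimes> r (Suc i) = inv (\<phi> (k i)) \<otimes> \<phi> (k (Suc i))"
      unfolding s_def r_def using k wi by (simp add: inv_mult_telescope)
    then have "\<phi> (b i) = inv (r i) \<otimes> s i \<otimes> r (Suc i)" unfolding b_def using k by simp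
    moreover have "b i \<in> carrier G" unfolding b_def using k by simp
    moreover have "out i \<in> insert None (Some ` A)" unfolding out_def using wA by (auto simp: n_def)
    ultimately have "(b i, out i) \<in> (\<lambda>c. (val c, tr c)) ` A'"
      unfolding letters using r s by blast
    then show ?thesis by auto
  qed
  then obtain c where c: "\<And>i. c i \<in> A'" "\<And>i. val (c i) = b i" "\<And>i. tr (c i) = out i" by metis
  define u where "u = map c [0..<Suc n]"
  have uA: "u \<in> lists A'" unfolding u_def using c(1) by auto
  have val: "val_word (map c [0..<j]) = k j" for j
  proof (induction j)
    case 0
    then show ?case by (simp add: k_def)
  next
    case (Suc j)
    have "map c [0..<j] \<in> lists A'" "[c j] \<in> lists A'" using c(1) by auto
    then have "val_word (map c [0..<Suc j]) = k j \<otimes> val_word [c j]"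
      using Suc by (simp add: lifted.eval_append)
    also have "val_word [c j] = b j" using c(2) k by (simp add: val_word_def b_def)
    also have "k j \<otimes> b j = k (Suc j)" unfolding b_def using k by (simp add: m_assoc[symmetric])
    finally show ?case .
  qed
  have tr_u: "map tr u = map Some w @ [None]"
  proof -
    have "map tr u = map out [0..<n] @ [out n]" unfolding u_def using c(3) by simp
    also have "map out [0..<n] = map (\<lambda>i. Some (w ! i)) [0..<n]" unfolding out_def by simp
    also have "\<dots> = map Some w" by (rule nth_equalityI) (simp_all add: n_def)
    finally show ?thesis by (simp add: out_def)
  qed
  have "offset (take i u) \<in> R" for i
  proof -
    have "take i u = map c [0..<min i (Suc n)]"
      unfolding u_def by (simp add: take_map take_upt min_def del: upt_Suc)
    moreover have "take i w = take (min i (Suc n)) w" by (simp add: n_def min_def)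
    ultimately have "offset (take i u) = r (min i (Suc n))"
      unfolding offset_def trace_take[OF tr_u] r_def by (simp add: val)
    then show ?thesis using r by simp
  qed
  moreover have gu: "val_word u = g" unfolding u_def val by (simp add: k_def)
  moreover have "offset u = \<one>"
    unfolding offset_def trace_eq[OF tr_u] gu using w(2) g by simp
  ultimately have "u \<in> lift" unfolding lift_def using uA tr_u w(1) by blast
  then show ?thesis using gu by blast
qed

text \<open>Along lifts \<open>u\<close>, \<open>v\<close> of \<open>w\<close>, \<open>w'\<close>, the image under \<open>\<phi>\<close> of a difference factors as an offset inverse from
  \<open>u\<close> to \<open>w\<close>, a difference of \<open>w\<close> and \<open>w'\<close>, and an offset from \<open>w'\<close> to \<open>v\<close>. The elements with such images form a
  finite set because the kernel is finite.\<close>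
lemma finite_differences_lift:
  assumes y: "y \<in> carrier G"
  shows "finite (lifted.differences lift y)"
proof -
  let ?S = "(\<lambda>(r, d, r'). inv r \<otimes> d \<otimes> r') ` (R \<times> differences L (\<phi> y) \<times> R)"
  have "lifted.differences lift y \<subseteq> {d \<in> carrier G. \<phi> d \<in> ?S}"
  proof
    fix d assume "d \<in> lifted.differences lift y"
    then obtain u v i where uv: "u \<in> lift" "v \<in> lift" "val_word v = val_word u \<otimes> y"
      and d: "d = inv (val_word (take i u)) \<otimes> val_word (take i v)"
      unfolding lifted.differences_def by blast
    obtain w where w: "w \<in> L" "\<pi> w = \<phi> (val_word u)"
        "inv (\<pi> (take i w)) \<otimes> \<phi> (val_word (take i u)) \<in> R"
      using lift_traceE[OF uv(1)] by metis
    obtain w' where w': "w' \<in> L" "\<pi> w' = \<phi> (val_word v)"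
        "inv (\<pi> (take i w')) \<otimes> \<phi> (val_word (take i v)) \<in> R"
      using lift_traceE[OF uv(2)] by metis
    have uvA: "u \<in> lists A'" "v \<in> lists A'" using uv unfolding lift_def by auto
    have "w \<in> lists A" "w' \<in> lists A" using w w' L_section by auto
    then have wA: "\<pi> (take i w) \<in> carrier G" "\<pi> (take i w') \<in> carrier G"
      using take_lists by blast+
    have valA: "val_word (take i u) \<in> carrier G" "val_word (take i v) \<in> carrier G"
      using uvA[THEN lifted.take_lists] by simp_all
    have "\<pi> w' = \<pi> w \<otimes> \<phi> y" using w w' uv uvA y by simp
    then have diff: "inv (\<pi> (take i w)) \<otimes> \<pi> (take i w') \<in> differences L (\<phi> y)"
      unfolding differences_def using w(1) w'(1) by blast
    have "\<phi> d = inv (inv (\<pi> (take i w)) \<otimes> \<phi> (val_word (take i u))) \<otimes>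
        (inv (\<pi> (take i w)) \<otimes> \<pi> (take i w')) \<otimes> (inv (\<pi> (take i w')) \<otimes> \<phi> (val_word (take i v)))"
      unfolding d using wA valA by (simp add: inv_mult_group inv_mult_telescope)
    then have "\<phi> d \<in> ?S"
      using w(3) w'(3) diff
      by (intro image_eqI[where x = "(inv (\<pi> (take i w)) \<otimes> \<phi> (val_word (take i u)),
            inv (\<pi> (take i w)) \<otimes> \<pi> (take i w'),
            inv (\<pi> (take i w')) \<otimes> \<phi> (val_word (take i v)))"]) simp_all
    then show "d \<in> {d \<in> carrier G. \<phi> d \<in> ?S}" unfolding d using valA by simp
  qed
  moreover have "finite ?S"
    using R(1) automatic_structure_finite_differences[OF aut, of "\<phi> y"] y by simp
  then have "finite {d \<in> carrier G. \<phi> d \<in> ?S}"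
    by (rule finite_vimage_of_finite_kernel[OF endo finite_ker])
  ultimately show ?thesis by (rule finite_subset)
qed

lemma automatic_structure_lift: "automatic_structure G A' val_word lift"
proof -
  have "lift \<subseteq> lists A'" unfolding lift_def by blast
  moreover have "val_word ` lift = carrier G"
    using lift_surj val_word_closed \<open>lift \<subseteq> lists A'\<close> by blast
  moreover have "val_word ` lists A' = carrier G"
    using lift_surj val_word_closed \<open>lift \<subseteq> lists A'\<close> by blast
  then have "generating_hom G A' val_word"
    unfolding generating_hom_def epi_def using finite_A' lifted.hom by (simp add: free_monoid_def)
  moreover have "finite (lifted.differences lift (val_word x))" if "x \<in> insert [] ((\<lambda>c. [c]) ` A')" for x
    using that by (intro finite_differences_lift val_word_closed) auto
  ultimately show ?thesis
    unfolding lifted.automatic_structure_iff_finite_differences is_section_def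
    using rational_lift by blast
qed

text \<open>The image of a lift \<open>\<alpha>\<close> stays near its underlying word \<open>w\<close>, and \<open>w\<close> fellow travels with \<open>\<beta>\<close> because both
  lie in \<open>L\<close> and represent the same element.\<close>
lemma synchronous_BRP_lift: "synchronous_BRP G val_word lift G A \<pi> L \<phi>"
proof -
  let ?S = "(\<lambda>(r, d). inv r \<otimes> d) ` (R \<times> differences L \<one>)"
  have diff_closed: "differences L \<one> \<subseteq> carrier G"
  proof
    fix d assume "d \<in> differences L \<one>"
    then obtain u v i where "u \<in> L" "v \<in> L" and d: "d = inv (\<pi> (take i u)) \<otimes> \<pi> (take i v)"
      unfolding differences_def by blast
    then have "u \<in> lists A" "v \<in> lists A" using L_section by auto
    then show "d \<in> carrier G" unfolding d by (intro m_closed inv_closed eval_closed take_lists)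
  qed
  have "finite ?S" using R(1) automatic_structure_finite_differences[OF aut, of \<one>] by simp
  moreover have "?S \<subseteq> carrier G" using R(2) diff_closed by auto
  moreover have "carrier G \<subseteq> \<pi> ` lists A" using L_section by blast
  ultimately obtain N where
    N: "\<And>g s. g \<in> carrier G \<Longrightarrow> s \<in> ?S \<Longrightarrow> word_dist G A \<pi> g (g \<otimes> s) \<le> N"
    using word_dist_bounded_on_finite by metis
  have "word_dist G A \<pi> (\<phi> (word_path G val_word \<alpha> x n)) (word_path G \<pi> \<beta> (\<phi> x) n) \<le> Suc N"
    if x: "x \<in> carrier G" and \<alpha>: "\<alpha> \<in> lift" and \<beta>: "\<beta> \<in> L" and eq: "\<pi> \<beta> = \<phi> (val_word \<alpha>)" for n x \<alpha> \<beta>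
  proof -
    obtain w where w: "w \<in> L" "\<pi> w = \<phi> (val_word \<alpha>)"
        "inv (\<pi> (take n w)) \<otimes> \<phi> (val_word (take n \<alpha>)) \<in> R"
      using lift_traceE[OF \<alpha>] by metis
    have "w \<in> lists A" "\<beta> \<in> lists A" "\<alpha> \<in> lists A'"
      using w \<beta> \<alpha> L_section unfolding lift_def by auto
    then have closed: "\<pi> (take n w) \<in> carrier G" "\<pi> (take n \<beta>) \<in> carrier G"
        "val_word (take n \<alpha>) \<in> carrier G" "\<pi> w \<in> carrier G"
      using take_lists lifted.take_lists by blast+
    let ?r = "inv (\<pi> (take n w)) \<otimes> \<phi> (val_word (take n \<alpha>))"
    let ?d = "inv (\<pi> (take n w)) \<otimes> \<pi> (take n \<beta>)"
    have "\<pi> \<beta> = \<pi> w \<otimes> \<one>" using eq w closed by simp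
    then have "?d \<in> differences L \<one>" unfolding differences_def using w \<beta> by blast
    then have "inv ?r \<otimes> ?d \<in> ?S" using w(3) by (intro image_eqI[OF _ SigmaI]) simp_all
    moreover have "\<phi> (x \<otimes> val_word (take n \<alpha>)) \<otimes> (inv ?r \<otimes> ?d) = \<phi> x \<otimes> \<pi> (take n \<beta>)"
    proof -
      have "inv ?r \<otimes> ?d = inv (\<phi> (val_word (take n \<alpha>))) \<otimes> \<pi> (take n \<beta>)"
        using closed by (simp add: inv_mult_group inv_mult_telescope)
      moreover have "\<phi> (val_word (take n \<alpha>)) \<otimes> (inv (\<phi> (val_word (take n \<alpha>))) \<otimes> \<pi> (take n \<beta>)) =
          \<pi> (take n \<beta>)"
        using closed by (simp add: m_assoc[symmetric])
      ultimately show ?thesis using x closed by (simp add: m_assoc)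
    qed
    ultimately show ?thesis
      using N[of "\<phi> (x \<otimes> val_word (take n \<alpha>))" "inv ?r \<otimes> ?d"] x closed
      unfolding word_path_def by simp
  qed
  then show ?thesis unfolding synchronous_BRP_def by blast
qed

end

section \<open>Virtually injective endomorphisms with quasiconvex image\<close>
theorem theorem4p12:
  fixes G :: "('g, 'm) monoid_scheme"
    and A :: "'a set" and \<pi> :: "'a list \<Rightarrow> 'g" and L :: "'a list set"
    and \<phi> :: "'g \<Rightarrow> 'g"
  assumes "group G"
    and "automatic_structure G A \<pi> L"
    and "virtually_injective_endo G \<phi>"
    and "quasiconvex G A \<pi> L (\<phi> ` carrier G)"
  shows "\<exists>(A' :: nat set) (\<pi>' :: nat list \<Rightarrow> 'g) (L' :: nat list set).
           automatic_structure G A' \<pi>' L' \<and> synchronous_BRP G \<pi>' L' G A \<pi> L \<phi>"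
proof -
  interpret group G by fact
  have "\<pi> \<in> hom (free_monoid A) G" and "finite A"
    and L: "L \<subseteq> lists A" "\<pi> ` L = carrier G"
    using assms(2) unfolding automatic_structure_def generating_hom_def epi_def is_section_def by auto
  interpret word_evaluation G A \<pi> by unfold_locales fact
  have endo: "\<phi> \<in> hom G G" and ker: "finite (kernel G G \<phi>)"
    using assms(3) unfolding virtually_injective_endo_def by auto
  interpret \<phi>: group_hom G G \<phi> using endo by unfold_locales
  have surj: "carrier G \<subseteq> \<pi> ` lists A" using L by blast
  obtain N where N: "\<And>h h' w n. h \<in> \<phi> ` carrier G \<Longrightarrow> h' \<in> \<phi> ` carrier G \<Longrightarrow> w \<in> L \<Longrightarrow>
      h \<otimes>\<^bsub>G\<^esub> \<pi> w = h' \<Longrightarrow> word_dist_set G A \<pi> (h \<otimes>\<^bsub>G\<^esub> \<pi> (take n w)) (\<phi> ` carrier G) \<le> N"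
    using assms(4) unfolding quasiconvex_def by blast
  define ball where
    "ball = {inv\<^bsub>G\<^esub> g \<otimes>\<^bsub>G\<^esub> h | g h. g \<in> carrier G \<and> h \<in> carrier G \<and> word_dist G A \<pi> g h \<le> N}"
  define R where "R = insert \<one>\<^bsub>G\<^esub> ball"
  have R: "finite R" "R \<subseteq> carrier G" "\<one>\<^bsub>G\<^esub> \<in> R"
    unfolding R_def ball_def using finite_word_ball[OF surj \<open>finite A\<close>] by auto
  \<comment> \<open>Quasiconvexity is applied to paths that start at the identity, an element of the image.\<close>
  have near: "\<exists>k\<in>carrier G. inv\<^bsub>G\<^esub> (\<pi> (take i w)) \<otimes>\<^bsub>G\<^esub> \<phi> k \<in> R"
    if w: "w \<in> L" "\<pi> w \<in> \<phi> ` carrier G" for w i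
  proof -
    have "w \<in> lists A" using w L by auto
    then have closed: "\<pi> (take i w) \<in> carrier G" "\<pi> w \<in> carrier G" using take_lists by auto
    have "\<one>\<^bsub>G\<^esub> \<in> \<phi> ` carrier G" using \<phi>.hom_one by (metis imageI one_closed)
    then have "word_dist_set G A \<pi> (\<pi> (take i w)) (\<phi> ` carrier G) \<le> N"
      using N[of "\<one>\<^bsub>G\<^esub>" "\<pi> w" w i] w closed by simp
    moreover have "word_dist_set G A \<pi> (\<pi> (take i w)) (\<phi> ` carrier G) \<in>
        word_dist G A \<pi> (\<pi> (take i w)) ` \<phi> ` carrier G"
      unfolding word_dist_set_def by (rule Inf_nat_def1) blast
    ultimately obtain k where k: "k \<in> carrier G" "word_dist G A \<pi> (\<pi> (take i w)) (\<phi> k) \<le> N"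
      by auto
    then have "inv\<^bsub>G\<^esub> (\<pi> (take i w)) \<otimes>\<^bsub>G\<^esub> \<phi> k \<in> ball"
      unfolding ball_def using closed(1) \<phi>.hom_closed by blast
    then show ?thesis unfolding R_def using k(1) by blast
  qed
  define S where "S = {b \<in> carrier G. \<exists>r\<in>R. \<exists>s\<in>insert \<one>\<^bsub>G\<^esub> ((\<lambda>a. \<pi> [a]) ` A). \<exists>r'\<in>R.
      \<phi> b = inv\<^bsub>G\<^esub> r \<otimes>\<^bsub>G\<^esub> s \<otimes>\<^bsub>G\<^esub> r'}"
  have "finite S"
  proof -
    let ?T = "(\<lambda>(r, s, r'). inv\<^bsub>G\<^esub> r \<otimes>\<^bsub>G\<^esub> s \<otimes>\<^bsub>G\<^esub> r') `
      (R \<times> insert \<one>\<^bsub>G\<^esub> ((\<lambda>a. \<pi> [a]) ` A) \<times> R)"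
    have "finite {b \<in> carrier G. \<phi> b \<in> ?T}"
      using R(1) \<open>finite A\<close> by (intro finite_vimage_of_finite_kernel endo ker) simp
    moreover have "S \<subseteq> {b \<in> carrier G. \<phi> b \<in> ?T}"
      unfolding S_def by (auto simp: image_iff)
    ultimately show ?thesis by (rule rev_finite_subset)
  qed
  then have "finite (S \<times> insert None (Some ` A))" using \<open>finite A\<close> by simp
  then obtain e :: "nat \<Rightarrow> 'g \<times> 'a option" and A' where "finite A'" "e ` A' = S \<times> insert None (Some ` A)"
    using ex_bij_betw_nat_finite unfolding bij_betw_def by (metis finite_atLeastLessThan)
  interpret lifted_language G A \<pi> L \<phi> R A' "fst \<circ> e" "snd \<circ> e"
    using assms(2) endo ker R near \<open>finite A'\<close> \<open>e ` A' = _\<close>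
    unfolding S_def by unfold_locales auto
  show ?thesis using automatic_structure_lift synchronous_BRP_lift by blast
qed

end
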